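(* For every pair of integers $r\ge 2$ and $d\ge 1$ and every hypergraph $\mathcal{H}$, \[ \mathcal{D}^d(\mathcal{H})\le \mathcal{D}^1(\mathcal{H})\le \mathcal{D}^{\circ}_r(\mathcal{H}). \]
   Context: A hypergraph $\mathcal{H}=(\mathcal{V},\mathcal{E})$ consists of a finite set $\mathcal{V}$ of vertices and a nonempty family $\mathcal{E}$ of subsets of $\mathcal{V}$ (hyperedges). Write $[r]=\{1,\dots,r\}$. For $r\ge 2$, the symmetric $r$-colour discrepancy of $\mathcal{H}$ is \[ \mathcal{D}^{\circ}_r(\mathcal{H})=\min_{f:\mathcal{V}\to[r]}\ \max_{A\in\mathcal{E}}\ \max_{j\in[r]}\ \Bigl|\,r\left|f^{-1}(j)\cap A\right|-|A|\,\Bigr| . \] For $d\ge 0$, let $\mathbb{S}^d$ be the unit sphere in $\mathbb{R}^{d+1}$ with the Euclidean norm $|\cdot|$. The $d$-dimensional discrepancy of $\mathcal{H}$ is \[ \mathcal{D}^d(\mathcal{H})=\min_{f:\mathcal{V}\to\mathbb{S}^d}\ \max_{A\in\mathcal{E}}\ \Bigl|\sum_{a\in A}f(a)\Bigr| . \] *)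

theory Defs
  imports "HOL-Analysis.Analysis"
begin

locale hypergraph =
  fixes V :: "'a set" and E :: "'a set set"
  assumes finite_vertices: "finite V"
    and edges_subset: "E \<subseteq> Pow V"
    and edges_nonempty: "E \<noteq> {}"

definition colour_imbalance :: "nat \<Rightarrow> 'a set set \<Rightarrow> ('a \<Rightarrow> nat) \<Rightarrow> real" where
  "colour_imbalance r E f =
     (MAX A\<in>E. MAX j\<in>{1..r}. \<bar>real r * real (card (f -` {j} \<inter> A)) - real (card A)\<bar>)"

definition sym_discrepancy :: "nat \<Rightarrow> 'a set \<Rightarrow> 'a set set \<Rightarrow> real" where
  "sym_discrepancy r V E = (MIN f\<in>V \<rightarrow>\<^sub>E {1..r}. colour_imbalance r E f)"

text \<open>
  The space \<open>\<real>\<close> to the power \<open>d + 1\<close> consists of the functions \<open>nat \<Rightarrow> real\<close> that vanish at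
  every index above \<open>d\<close>, as in \<^const>\<open>Euclidean_space\<close> and \<^const>\<open>nsphere\<close>; on it
  \<open>L2_set x {..d}\<close> is the Euclidean norm of \<open>x\<close>.
\<close>

definition vector_imbalance :: "nat \<Rightarrow> 'a set set \<Rightarrow> ('a \<Rightarrow> nat \<Rightarrow> real) \<Rightarrow> real" where
  "vector_imbalance d E f = (MAX A\<in>E. L2_set (\<lambda>i. \<Sum>a\<in>A. f a i) {..d})"

text \<open>The infimum is attained for every hypergraph; see \<open>dim_discrepancy_attained\<close> below.\<close>

definition dim_discrepancy :: "nat \<Rightarrow> 'a set \<Rightarrow> 'a set set \<Rightarrow> real" where
  "dim_discrepancy d V E = (INF f\<in>V \<rightarrow>\<^sub>E topspace (nsphere d). vector_imbalance d E f)"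

lemma compact_nsphere: "compact (topspace (nsphere d))"
proof -
  let ?B = "Pi\<^sub>E UNIV (\<lambda>i::nat. if i \<le> d then {-1..1::real} else {0})"
  have "compactin (product_topology (\<lambda>i. euclidean) UNIV) ?B"
    by (subst compactin_PiE) auto
  then have B: "compact ?B"
    by (simp add: euclidean_product_topology)
  have top: "topspace (nsphere d) =
      {x. (\<Sum>i\<le>d. x i ^ 2) = 1} \<inter> (\<Inter>i\<in>{d<..}. {x. x i = 0})"
    by (auto simp: nsphere)
  have co: "continuous_on UNIV (\<lambda>x::nat \<Rightarrow> real. x i)" for i
    by (rule continuous_on_product_coordinates)
  have c: "closed (topspace (nsphere d))"
    unfolding top
    by (intro closed_Int closed_INT ballI closed_Collect_eq continuous_intros co)
  have "topspace (nsphere d) \<subseteq> ?B"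
  proof
    fix x :: "nat \<Rightarrow> real"
    assume x: "x \<in> topspace (nsphere d)"
    have "\<bar>x i\<bar> \<le> 1" if "i \<le> d" for i
    proof -
      have "x i ^ 2 \<le> (\<Sum>i\<le>d. x i ^ 2)"
        using that by (intro member_le_sum) auto
      then show ?thesis
        using x by (simp add: nsphere abs_square_le_1)
    qed
    then show "x \<in> ?B"
      using x by (force simp: nsphere abs_le_iff)
  qed
  then show ?thesis
    using compact_Int_closed [OF B c] by (simp add: Int_absorb1)
qed

lemma continuous_on_vector_imbalance:
  fixes S :: "('a \<Rightarrow> nat \<Rightarrow> real) set"
  assumes "finite E" "E \<noteq> {}"
  shows "continuous_on S (vector_imbalance d E)"
proof -
  have co: "continuous_on S (\<lambda>f. f a i)" for a i
  proof (rule continuous_on_product_then_coordinatewise)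
    show "continuous_on S (\<lambda>f. f a)"
      by (rule continuous_on_subset [OF continuous_on_product_coordinates]) auto
  qed
  have L: "continuous_on S (\<lambda>f. L2_set (\<lambda>i. \<Sum>a\<in>A. f a i) {..d})" for A
    unfolding L2_set_def
    by (intro continuous_on_real_sqrt continuous_on_sum continuous_on_power co)
  show ?thesis
    unfolding vector_imbalance_def [abs_def] using assms
  proof (induction E rule: finite_ne_induct)
    case (singleton A)
    then show ?case using L by simp
  next
    case (insert A F)
    then show ?case
      using L [of A] by (simp add: continuous_on_max)
  qed
qed

lemma dim_discrepancy_attained:
  assumes "hypergraph V E"
  shows "\<exists>f\<in>V \<rightarrow>\<^sub>E topspace (nsphere d).
           dim_discrepancy d V E = vector_imbalance d E f \<and>
           (\<forall>g\<in>V \<rightarrow>\<^sub>E topspace (nsphere d). vector_imbalance d E f \<le> vector_imbalance d E g)"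
proof -
  interpret hypergraph V E by fact
  let ?F = "V \<rightarrow>\<^sub>E topspace (nsphere d)"
  have E: "finite E"
    using finite_vertices edges_subset by (meson finite_Pow_iff finite_subset)
  have F: "?F = Pi\<^sub>E UNIV (\<lambda>a. if a \<in> V then topspace (nsphere d) else {undefined})"
    by (auto simp: PiE_def Pi_def extensional_def split: if_splits)
  have "compactin (product_topology (\<lambda>_. euclidean) UNIV) ?F"
    unfolding F by (subst compactin_PiE) (auto simp: compact_nsphere)
  then have "compact ?F"
    by (simp add: euclidean_product_topology)
  moreover have "?F \<noteq> {}"
    using in_topspace_nsphere [of d] by (auto simp: PiE_eq_empty_iff)
  ultimately obtain f where f: "f \<in> ?F" "\<forall>g\<in>?F. vector_imbalance d E f \<le> vector_imbalance d E g"
    using continuous_attains_inf [OF _ _ continuous_on_vector_imbalance [OF E edges_nonempty]]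
    by blast
  then have "dim_discrepancy d V E = vector_imbalance d E f"
    unfolding dim_discrepancy_def by (intro cInf_eq_minimum) auto
  with f show ?thesis by blast
qed

end

theory Submission
  imports Defs
begin

text \<open>
  The circle embeds into every sphere of higher dimension by appending zero coordinates, and this
  does not change the norm of any sum over an edge; hence the first inequality.

  For the second, send colour \<open>j\<close> to the point \<open>exp (2\<pi>ij/r)\<close> of the circle. If an edge \<open>A\<close> has
  \<open>n\<^sub>j\<close> vertices of colour \<open>j\<close>, its vector sum is \<open>\<Sum>\<^sub>j n\<^sub>j exp (2\<pi>ij/r)\<close>. The \<open>r\<close>-th roots of
  unity sum to zero, so every \<open>n\<^sub>j\<close> may be replaced by \<open>n\<^sub>j - |A|/r\<close>. Each of the \<open>r\<close> resulting
  terms has modulus \<open>|r n\<^sub>j - |A|| / r\<close>, and the triangle inequality bounds their sum by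
  \<open>max\<^sub>j |r n\<^sub>j - |A||\<close>.
\<close>

text \<open>
  As the vectors \<open>u j\<close> sum to zero, subtracting the mean \<open>card A / card J\<close> from every class size
  does not change the sum, and what remains are \<open>card J\<close> terms of norm at most \<open>D / card J\<close>.
\<close>

lemma norm_sum_colour_vectors_le:
  fixes u :: "'c \<Rightarrow> 'b::real_normed_vector" and f :: "'a \<Rightarrow> 'c"
  assumes A: "finite A" "f ` A \<subseteq> J"
    and J: "finite J" "J \<noteq> {}"
    and sum0: "(\<Sum>j\<in>J. u j) = 0"
    and unit: "\<And>j. j \<in> J \<Longrightarrow> norm (u j) \<le> 1"
    and D: "\<And>j. j \<in> J \<Longrightarrow> \<bar>real (card J) * real (card (f -` {j} \<inter> A)) - real (card A)\<bar> \<le> D"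
  shows "norm (\<Sum>a\<in>A. u (f a)) \<le> D"
proof -
  define n where "n j = real (card (f -` {j} \<inter> A))" for j
  define r where "r = real (card J)"
  have r: "r > 0"
    using J by (simp add: r_def card_gt_0_iff)
  have "(\<Sum>a\<in>A. u (f a)) = (\<Sum>j\<in>J. \<Sum>a\<in>{a\<in>A. f a = j}. u (f a))"
    using sum.group [OF A(1) J(1) A(2), of "\<lambda>a. u (f a)"] by simp
  also have "\<dots> = (\<Sum>j\<in>J. n j *\<^sub>R u j)"
  proof (rule sum.cong [OF refl])
    fix j
    have "{a\<in>A. f a = j} = f -` {j} \<inter> A" by auto
    then show "(\<Sum>a\<in>{a\<in>A. f a = j}. u (f a)) = n j *\<^sub>R u j"
      by (simp add: n_def sum_constant_scaleR)
  qed
  finally have group: "(\<Sum>a\<in>A. u (f a)) = (\<Sum>j\<in>J. n j *\<^sub>R u j)" .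
  have "r *\<^sub>R (\<Sum>a\<in>A. u (f a)) = (\<Sum>j\<in>J. (r * n j) *\<^sub>R u j) - real (card A) *\<^sub>R (\<Sum>j\<in>J. u j)"
    unfolding group sum0 by (simp add: scaleR_sum_right)
  also have "\<dots> = (\<Sum>j\<in>J. (r * n j - real (card A)) *\<^sub>R u j)"
    by (simp add: scaleR_sum_right scaleR_left_diff_distrib sum_subtractf)
  finally have "r * norm (\<Sum>a\<in>A. u (f a)) = norm (\<Sum>j\<in>J. (r * n j - real (card A)) *\<^sub>R u j)"
    using r by (metis abs_of_pos norm_scaleR)
  also have "\<dots> \<le> (\<Sum>j\<in>J. D)"
  proof (rule sum_norm_le)
    fix j assume j: "j \<in> J"
    have "\<bar>r * n j - real (card A)\<bar> * norm (u j) \<le> \<bar>r * n j - real (card A)\<bar> * 1"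
      using unit [OF j] by (intro mult_left_mono) auto
    with D [OF j] show "norm ((r * n j - real (card A)) *\<^sub>R u j) \<le> D"
      by (simp add: n_def r_def)
  qed
  also have "\<dots> = r * D"
    by (simp add: r_def)
  finally show ?thesis
    using r by simp
qed

lemma sum_cis_roots_of_unity:
  assumes "r \<ge> 2"
  shows "(\<Sum>j\<in>{1..r}. cis (2 * pi * real j / real r)) = 0"
proof -
  have r: "r > 0" "r > 1" using assms by auto
  have "(\<Sum>j\<in>{1..r}. cis (2 * pi * real j / real r)) = (\<Sum>j<r. cis (2 * pi * real (Suc j) / real r))"
    by (simp only: One_nat_def sum.atLeast1_atMost_eq)
  also have "\<dots> = cis (2 * pi / real r) * (\<Sum>j<r. cis (2 * pi * real j / real r))"
    unfolding sum_distrib_left cis_mult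
    by (intro sum.cong refl arg_cong [of _ _ cis]) (simp add: field_simps)
  also have "(\<Sum>j<r. cis (2 * pi * real j / real r)) = \<Sum>{z::complex. z ^ r = 1}"
    using sum.reindex_bij_betw [OF Complex.bij_betw_roots_unity [OF r(1)], of "\<lambda>z. z"] by simp
  also have "\<dots> = 0"
    using sum_roots_unity [OF r(2)] .
  finally show ?thesis by simp
qed

definition plane_vector :: "complex \<Rightarrow> nat \<Rightarrow> real" where
  "plane_vector z = (\<lambda>i. if i = 0 then Re z else if i = 1 then Im z else 0)"

lemma plane_vector_in_nsphere:
  assumes "norm z = 1"
  shows "plane_vector z \<in> topspace (nsphere 1)"
proof -
  have "(norm z)\<^sup>2 = 1" using assms by simp
  then have "(Re z)\<^sup>2 + (Im z)\<^sup>2 = 1" by (simp add: cmod_power2)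
  then show ?thesis by (simp add: nsphere plane_vector_def)
qed

lemma L2_set_sum_plane_vector:
  "L2_set (\<lambda>i. \<Sum>a\<in>A. plane_vector (h a) i) {..1} = norm (\<Sum>a\<in>A. h a)"
  by (simp add: L2_set_def plane_vector_def cmod_def)

lemma nsphere_topspace_mono:
  assumes "m \<le> n"
  shows "topspace (nsphere m) \<subseteq> topspace (nsphere n)"
proof
  fix x assume x: "x \<in> topspace (nsphere m)"
  then have "(\<Sum>i\<le>n. (x i)\<^sup>2) = (\<Sum>i\<le>m. (x i)\<^sup>2)"
    using assms by (intro sum.mono_neutral_right) (auto simp: nsphere)
  with x assms show "x \<in> topspace (nsphere n)"
    by (auto simp: nsphere)
qed

context hypergraph
begin

lemma finite_edges: "finite E"
  using finite_vertices edges_subset by (meson finite_Pow_iff finite_subset)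

lemma vector_imbalance_le_iff:
  "vector_imbalance d E f \<le> D \<longleftrightarrow> (\<forall>A\<in>E. L2_set (\<lambda>i. \<Sum>a\<in>A. f a i) {..d} \<le> D)"
  using finite_edges edges_nonempty by (simp add: vector_imbalance_def)

lemma dim_discrepancy_le:
  assumes "f \<in> V \<rightarrow>\<^sub>E topspace (nsphere d)"
  shows "dim_discrepancy d V E \<le> vector_imbalance d E f"
  using dim_discrepancy_attained [OF hypergraph_axioms, of d] assms by auto

text \<open>
  A colouring that is optimal for the smaller sphere is admissible for the larger one, and its
  sums over edges have no coordinates beyond the smaller dimension.
\<close>

lemma dim_discrepancy_antimono:
  assumes "m \<le> n"
  shows "dim_discrepancy n V E \<le> dim_discrepancy m V E"
proof -
  obtain f where f: "f \<in> V \<rightarrow>\<^sub>E topspace (nsphere m)"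
    and opt: "dim_discrepancy m V E = vector_imbalance m E f"
    using dim_discrepancy_attained [OF hypergraph_axioms] by blast
  have "L2_set (\<lambda>i. \<Sum>a\<in>A. f a i) {..n} = L2_set (\<lambda>i. \<Sum>a\<in>A. f a i) {..m}" if "A \<in> E" for A
  proof -
    have "(\<Sum>a\<in>A. f a i) = 0" if "i > m" for i
      using f that \<open>A \<in> E\<close> edges_subset by (intro sum.neutral) (force simp: nsphere)
    then show ?thesis
      using assms unfolding L2_set_def
      by (intro arg_cong [of _ _ sqrt] sum.mono_neutral_right) auto
  qed
  then have "vector_imbalance n E f = vector_imbalance m E f"
    by (simp add: vector_imbalance_def)
  moreover have "f \<in> V \<rightarrow>\<^sub>E topspace (nsphere n)"
    using f nsphere_topspace_mono [OF assms] by blast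
  ultimately show ?thesis
    using opt dim_discrepancy_le by metis
qed

lemma dim_discrepancy_1_le_colour_imbalance:
  assumes r: "r \<ge> 2" and f: "f \<in> V \<rightarrow>\<^sub>E {1..r}"
  shows "dim_discrepancy 1 V E \<le> colour_imbalance r E f"
proof -
  define u where "u j = cis (2 * pi * real j / real r)" for j
  define g where "g = restrict (\<lambda>a. plane_vector (u (f a))) V"
  have "vector_imbalance 1 E g \<le> colour_imbalance r E f"
    unfolding vector_imbalance_le_iff
  proof
    fix A assume A: "A \<in> E"
    then have AV: "A \<subseteq> V" using edges_subset by auto
    have "\<bar>real r * real (card (f -` {j} \<inter> A)) - real (card A)\<bar> \<le> colour_imbalance r E f"
      if j: "j \<in> {1..r}" for j
    proof -
      have "\<bar>real r * real (card (f -` {j} \<inter> A)) - real (card A)\<bar>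
          \<le> (MAX j\<in>{1..r}. \<bar>real r * real (card (f -` {j} \<inter> A)) - real (card A)\<bar>)"
        using j by (intro Max_ge) auto
      also have "\<dots> \<le> colour_imbalance r E f"
        unfolding colour_imbalance_def using A finite_edges by (intro Max_ge) auto
      finally show ?thesis .
    qed
    then have "norm (\<Sum>a\<in>A. u (f a)) \<le> colour_imbalance r E f"
      using AV f r finite_subset [OF AV finite_vertices]
      by (intro norm_sum_colour_vectors_le [where J = "{1..r}"])
        (auto simp: u_def sum_cis_roots_of_unity [simplified])
    moreover have "(\<lambda>i. \<Sum>a\<in>A. g a i) = (\<lambda>i. \<Sum>a\<in>A. plane_vector (u (f a)) i)"
      using AV by (intro ext sum.cong) (auto simp: g_def)
    ultimately show "L2_set (\<lambda>i. \<Sum>a\<in>A. g a i) {..1} \<le> colour_imbalance r E f"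
      by (simp only: L2_set_sum_plane_vector)
  qed
  moreover have "g \<in> V \<rightarrow>\<^sub>E topspace (nsphere 1)"
    by (auto simp: g_def u_def intro!: plane_vector_in_nsphere [simplified])
  ultimately show ?thesis
    using dim_discrepancy_le order_trans by blast
qed

lemma sym_discrepancy_attained:
  assumes "r \<ge> 1"
  shows "\<exists>f\<in>V \<rightarrow>\<^sub>E {1..r}. sym_discrepancy r V E = colour_imbalance r E f"
proof -
  have "finite (V \<rightarrow>\<^sub>E {1..r})" "V \<rightarrow>\<^sub>E {1..r} \<noteq> {}"
    using finite_vertices assms by (auto simp: PiE_eq_empty_iff intro: finite_PiE)
  then have "sym_discrepancy r V E \<in> colour_imbalance r E ` (V \<rightarrow>\<^sub>E {1..r})"
    unfolding sym_discrepancy_def by (intro Min_in) auto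
  then show ?thesis by auto
qed

end

theorem proposition6:
  fixes r d :: nat and V :: "'a set" and E :: "'a set set"
  assumes "r \<ge> 2" and "d \<ge> 1" and "hypergraph V E"
  shows "dim_discrepancy d V E \<le> dim_discrepancy 1 V E \<and>
         dim_discrepancy 1 V E \<le> sym_discrepancy r V E"
proof -
  interpret hypergraph V E by fact
  obtain f where "f \<in> V \<rightarrow>\<^sub>E {1..r}" "sym_discrepancy r V E = colour_imbalance r E f"
    using sym_discrepancy_attained [of r] assms(1) by auto
  then show ?thesis
    using dim_discrepancy_antimono [OF assms(2)]
      dim_discrepancy_1_le_colour_imbalance [OF assms(1)] by simp
qed

end
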